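(* Let $\mathbf{f}$ be the Fibonacci word and $\tau=(1+\sqrt5)/2$. Then $P(\mathbf{f}) = \frac{1}{\tau^2\ln\tau} \approx 0.79375857$ and $p(\mathbf{f}) = \frac{1}{2\tau^2\ln\tau} \approx 0.396879286$.
   Context: The Fibonacci word $\mathbf{f}=01001010\cdots$ is the fixed point of the morphism $0\mapsto01$, $1\mapsto0$. For a finite nonempty word $w$, an integer $p$ with $1\le p\le|w|$ is a period if $w[i]=w[i+p]$ for $1\le i\le |w|-p$; it is nontrivial if $p<|w|$; $\operatorname{nnp}(w)$ is the number of nontrivial periods; $\operatorname{per}(w)$ the least period; $\exp(w)=|w|/\operatorname{per}(w)$; $\operatorname{ice}(w)=\sup\{\exp(u): u \text{ a nonempty prefix of } w\}$. For a finite word $x$ with $|x|\ge2$ let $M(x)=\operatorname{nnp}(x)/(\operatorname{ice}(x)\ln|x|)$. For an infinite word $\mathbf{x}$ with length-$n$ prefix $Y_n$, define $P(\mathbf{x})=\limsup_{n\to\infty} M(Y_n)$ and $p(\mathbf{x})=\liminf_{n\to\infty} M(Y_n)$. *)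

theory Defs
  imports "HOL-Library.Extended_Real" "HOL-Library.Stream" "HOL-Library.Sublist"
begin

text \<open>
  Finite words are lists (indexed from 0), infinite words are streams, and the binary alphabet is
  \<open>{0, 1} \<subseteq> nat\<close>.
\<close>

definition fib_morph :: "nat \<Rightarrow> nat list" where
  "fib_morph a = (if a = 0 then [0, 1] else [0])"

text \<open>
  \<open>flat (smap \<phi> s)\<close> is the extension of a non-erasing morphism \<open>\<phi>\<close> to infinite words. The definite
  description is well defined by \<open>fib_word_ex1\<close> below. The value of \<open>fib_morph\<close> at numbers greater
  than 1 is irrelevant, as such numbers do not occur in any image.
\<close>

definition fib_word :: "nat stream" where
  "fib_word = (THE s. flat (smap fib_morph s) = s)"

definition is_period :: "'a list \<Rightarrow> nat \<Rightarrow> bool" where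
  "is_period w p \<longleftrightarrow>
     1 \<le> p \<and> p \<le> length w \<and> (\<forall>i. i + p < length w \<longrightarrow> w ! i = w ! (i + p))"

definition nnp :: "'a list \<Rightarrow> nat" where
  "nnp w = card {p. is_period w p \<and> p < length w}"

definition per :: "'a list \<Rightarrow> nat" where
  "per w = (LEAST p. is_period w p)"

definition word_exp :: "'a list \<Rightarrow> real" where
  "word_exp w = real (length w) / real (per w)"

definition ice :: "'a list \<Rightarrow> real" where
  "ice w = Sup {word_exp u | u. u \<noteq> [] \<and> prefix u w}"

definition period_ratio :: "'a list \<Rightarrow> real" where
  "period_ratio x = real (nnp x) / (ice x * ln (real (length x)))"

definition limsup_ratio :: "'a stream \<Rightarrow> ereal" where
  "limsup_ratio x = limsup (\<lambda>n. ereal (period_ratio (stake n x)))"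

definition liminf_ratio :: "'a stream \<Rightarrow> ereal" where
  "liminf_ratio x = liminf (\<lambda>n. ereal (period_ratio (stake n x)))"

definition tau :: real where
  "tau = (1 + sqrt 5) / 2"

lemma fib_morph_neq_Nil [simp]: "fib_morph a \<noteq> []"
  by (simp add: fib_morph_def)

lemma flat_smap_fib_morph_shift:
  "flat (smap fib_morph (w @- s)) = concat (map fib_morph w) @- flat (smap fib_morph s)"
  by (induction w) auto

definition fib_iter :: "nat \<Rightarrow> nat list" where
  "fib_iter n = ((\<lambda>w. concat (map fib_morph w)) ^^ n) [0]"

lemma fib_iter_0: "fib_iter 0 = [0]"
  by (simp add: fib_iter_def)

lemma fib_iter_Suc: "fib_iter (Suc n) = concat (map fib_morph (fib_iter n))"
  by (simp add: fib_iter_def)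

lemma fib_iter_Suc_append: "\<exists>u. u \<noteq> [] \<and> fib_iter (Suc n) = fib_iter n @ u"
proof (induction n)
  case 0
  show ?case by (simp add: fib_iter_Suc fib_iter_0 fib_morph_def)
next
  case (Suc n)
  then obtain u where u: "u \<noteq> []" "fib_iter (Suc n) = fib_iter n @ u" by blast
  have "fib_iter (Suc (Suc n)) = concat (map fib_morph (fib_iter n @ u))"
    using u(2) fib_iter_Suc[of "Suc n"] by simp
  also have "\<dots> = fib_iter (Suc n) @ concat (map fib_morph u)"
    by (simp add: fib_iter_Suc)
  finally have "fib_iter (Suc (Suc n)) = fib_iter (Suc n) @ concat (map fib_morph u)" .
  moreover have "concat (map fib_morph u) \<noteq> []"
    using u(1) by (cases u) auto
  ultimately show ?case by blast
qed

lemma length_fib_iter: "n < length (fib_iter n)"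
proof (induction n)
  case (Suc n)
  obtain u where "u \<noteq> []" "fib_iter (Suc n) = fib_iter n @ u"
    using fib_iter_Suc_append by blast
  then show ?case using Suc by (cases u) auto
qed (simp add: fib_iter_0)

lemma prefix_fib_iter: "m \<le> n \<Longrightarrow> prefix (fib_iter m) (fib_iter n)"
proof (induction n rule: dec_induct)
  case (step n)
  moreover have "prefix (fib_iter n) (fib_iter (Suc n))"
    using fib_iter_Suc_append[of n] by auto
  ultimately show ?case using prefix_order.trans by blast
qed simp

lemma nth_fib_iter:
  assumes "i < length (fib_iter m)" "i < length (fib_iter n)"
  shows "fib_iter m ! i = fib_iter n ! i"
  using assms prefix_fib_iter[of m n] prefix_fib_iter[of n m]
  by (cases m n rule: linorder_le_cases) (auto simp: prefix_def nth_append)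

lemma fib_fixpoint_shift:
  assumes "flat (smap fib_morph s) = s"
  shows "\<exists>t. s = fib_iter n @- t"
proof (induction n)
  case 0
  have "shd s = shd (flat (smap fib_morph s))" using assms by simp
  also have "\<dots> = 0" by (simp add: fib_morph_def)
  finally have "s = fib_iter 0 @- stl s" by (cases s) (simp add: fib_iter_0)
  then show ?case by blast
next
  case (Suc n)
  then obtain t where t: "s = fib_iter n @- t" by blast
  have "s = flat (smap fib_morph (fib_iter n @- t))" using assms t by simp
  then show ?case unfolding flat_smap_fib_morph_shift fib_iter_Suc by blast
qed

lemma fib_fixpoint_snth:
  assumes "flat (smap fib_morph s) = s"
  shows "s !! n = fib_iter n ! n"
proof -
  obtain t where "s = fib_iter n @- t" using fib_fixpoint_shift[OF assms] by blast
  then show ?thesis using length_fib_iter[of n] by simp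
qed

lemma stream_eqI_snth: "(\<And>n. s !! n = t !! n) \<Longrightarrow> s = t"
  by (metis ext stream_smap_nats)

lemma fib_word_ex1: "\<exists>!s. flat (smap fib_morph s) = s"
proof (rule ex_ex1I)
  define f where "f = smap (\<lambda>n. fib_iter n ! n) nats"
  have f_nth: "f !! n = fib_iter n ! n" for n by (simp add: f_def)
  have f_shift: "f = fib_iter n @- sdrop (length (fib_iter n)) f" for n
  proof -
    have "stake (length (fib_iter n)) f = fib_iter n"
      by (rule nth_equalityI) (auto simp: f_nth intro: nth_fib_iter length_fib_iter)
    then show ?thesis by (metis stake_sdrop)
  qed
  have "flat (smap fib_morph f) !! n = f !! n" for n
  proof -
    have "flat (smap fib_morph f) =
        fib_iter (Suc n) @- flat (smap fib_morph (sdrop (length (fib_iter n)) f))"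
      by (subst f_shift[of n]) (simp only: flat_smap_fib_morph_shift fib_iter_Suc)
    moreover have "n < length (fib_iter (Suc n))"
      using length_fib_iter[of "Suc n"] by simp
    ultimately show ?thesis
      using nth_fib_iter[of n "Suc n" n] length_fib_iter[of n] by (simp add: f_nth)
  qed
  then show "\<exists>s. flat (smap fib_morph s) = s" by (blast intro: stream_eqI_snth)
next
  fix s t
  assume "flat (smap fib_morph s) = s" "flat (smap fib_morph t) = t"
  then show "s = t" by (intro stream_eqI_snth) (simp add: fib_fixpoint_snth)
qed

lemma fib_word_fixpoint: "flat (smap fib_morph fib_word) = fib_word"
  unfolding fib_word_def by (rule theI'[OF fib_word_ex1])

end

theory Submission
  imports Defs "HOL-Analysis.Harmonic_Numbers"
begin

text \<open>
  Let \<open>L\<^sub>0 = 1, L\<^sub>1 = 2, L\<^sub>2 = 3, L\<^sub>3 = 5, \<dots>\<close> be the lengths of the finite Fibonacci words. If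
  \<open>L\<^sub>k\<^sub>+\<^sub>1 \<le> n + 1 < L\<^sub>k\<^sub>+\<^sub>2\<close>, then the least period of the prefix of length \<open>n\<close> is \<open>L\<^sub>k\<close>. Hence the
  initial critical exponent tends to \<open>lim (L\<^sub>k\<^sub>+\<^sub>2 - 2) / L\<^sub>k = \<tau>\<^sup>2\<close>, and removing the least period,
  that is, passing to the longest border, lowers the Fibonacci index of \<open>n + 1\<close> by one or two.
  The number of nontrivial periods therefore lies between half that index and the index itself,
  up to a constant. The upper extreme is attained for \<open>n = L\<^sub>k - 2\<close>, where every step lowers the
  index by one, and the lower extreme for \<open>n = L\<^sub>k - 1\<close>, where every step lowers it by two. As the
  index is asymptotically \<open>ln n / ln \<tau>\<close>, both limits follow.
\<close>

section \<open>Periods and borders of arbitrary words\<close>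

lemma per_eqI:
  assumes "is_period w p" "\<And>q. is_period w q \<Longrightarrow> p \<le> q"
  shows "per w = p"
  unfolding per_def using assms by (rule Least_equality)

lemma is_period_length: "w \<noteq> [] \<Longrightarrow> is_period w (length w)"
  by (simp add: is_period_def Suc_le_eq)

lemma is_period_per: "w \<noteq> [] \<Longrightarrow> is_period w (per w)"
  unfolding per_def by (rule LeastI[of _ "length w"]) (rule is_period_length)

lemma per_le: "is_period w q \<Longrightarrow> per w \<le> q"
  unfolding per_def by (rule Least_le)

text \<open>The period \<open>p\<close> identifies the letters at \<open>i + q\<close> and
  \<open>i + p + q\<close>, so a shift by \<open>p + q\<close> in \<open>w\<close> can be tested as
  a shift by \<open>q\<close> inside the border of length \<open>length w - p\<close>.\<close>

lemma is_period_add_iff: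
  assumes "is_period w p" "p < length w" "1 \<le> q"
  shows "is_period w (p + q) \<longleftrightarrow> is_period (take (length w - p) w) q"
proof -
  have "w ! i = w ! (i + (p + q)) \<longleftrightarrow> w ! i = w ! (i + q)" if "i + (p + q) < length w" for i
  proof -
    have "w ! (i + q) = w ! (i + q + p)"
      using assms(1) that unfolding is_period_def by (auto simp: add.assoc add.commute)
    then show ?thesis by (simp add: ac_simps)
  qed
  then show ?thesis
    using assms unfolding is_period_def by (auto simp: less_diff_conv ac_simps)
qed

text \<open>The proper borders of a word are its longest border together with the borders of that.\<close>

lemma nnp_rec:
  assumes "per w < length w"
  shows "nnp w = Suc (nnp (take (length w - per w) w))"
proof -
  define p where "p = per w"
  define v where "v = take (length w - p) w"
  have p: "is_period w p" "p < length w"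
    using assms is_period_per[of w] by (cases "w = []"; simp add: p_def)+
  have len: "length v = length w - p" by (simp add: v_def)
  have "{r. is_period w r \<and> r < length w} =
      insert p ((+) p ` {q. is_period v q \<and> q < length v})" (is "?A = insert p ?B")
  proof (intro equalityI subsetI)
    fix r assume r: "r \<in> ?A"
    then have "p \<le> r" using per_le p_def by blast
    show "r \<in> insert p ?B"
    proof (cases "r = p")
      case False
      then have "is_period v (r - p)"
        using is_period_add_iff[OF p, of "r - p"] r \<open>p \<le> r\<close> by (simp add: v_def)
      then have "r - p \<in> {q. is_period v q \<and> q < length v}"
        using r len False \<open>p \<le> r\<close> by auto
      then have "p + (r - p) \<in> ?B" by (rule imageI)
      then show ?thesis using \<open>p \<le> r\<close> by simp
    qed simp
  next
    fix r assume "r \<in> insert p ?B"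
    then consider "r = p" | q where "r = p + q" "is_period v q" "q < length v" by auto
    then show "r \<in> ?A"
    proof cases
      case 2
      then have "1 \<le> q" by (simp add: is_period_def)
      then show ?thesis using is_period_add_iff[OF p, of q] 2 len by (auto simp: v_def)
    qed (use p in simp)
  qed
  moreover have "p \<notin> ?B" by (auto simp: is_period_def)
  moreover have "finite ?B" by simp
  ultimately have "card ?A = Suc (card ?B)" by simp
  also have "card ?B = card {q. is_period v q \<and> q < length v}"
    by (rule card_image) simp
  finally show ?thesis by (simp add: nnp_def p_def v_def)
qed

lemma is_period_stake:
  "is_period (stake n s) p \<longleftrightarrow>
     1 \<le> p \<and> p \<le> n \<and> (\<forall>i. i + p < n \<longrightarrow> s !! i = s !! (i + p))"
  unfolding is_period_def by (auto simp: stake_nth)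

lemma is_period_stake_mono:
  "is_period (stake n s) p \<Longrightarrow> p \<le> m \<Longrightarrow> m \<le> n \<Longrightarrow> is_period (stake m s) p"
  unfolding is_period_stake by auto

lemma prefix_stake_iff: "prefix u (stake n s) \<longleftrightarrow> (\<exists>m\<le>n. u = stake m s)"
proof
  assume "prefix u (stake n s)"
  then have "u = take (length u) (stake n s)" "length u \<le> n"
    by (auto simp: prefix_def dest: arg_cong[of _ _ length])
  then show "\<exists>m\<le>n. u = stake m s" by (metis take_stake min.absorb2 min.commute)
next
  assume "\<exists>m\<le>n. u = stake m s"
  then show "prefix u (stake n s)" by (metis take_stake min.absorb1 take_is_prefix)
qed

section \<open>Finite Fibonacci words and their lengths\<close>

definition fib_len :: "nat \<Rightarrow> nat" where
  "fib_len k = length (fib_iter k)"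

text \<open>The morphism respects concatenation, so each instance is the image of the previous
  one.\<close>

lemma fib_iter_rec: "fib_iter (Suc (Suc k)) = fib_iter (Suc k) @ fib_iter k"
proof (induction k)
  case (Suc k)
  then show ?case by (metis concat_append fib_iter_Suc map_append)
qed (simp add: fib_iter_Suc fib_iter_0 fib_morph_def)

lemma fib_len_simps [simp]:
  "fib_len 0 = 1" "fib_len (Suc 0) = 2" "fib_len (Suc (Suc k)) = fib_len (Suc k) + fib_len k"
  by (simp_all add: fib_len_def fib_iter_rec) (simp_all add: fib_iter_Suc fib_iter_0 fib_morph_def)

lemma fib_len_gt: "k < fib_len k"
  by (simp add: fib_len_def length_fib_iter)

lemma strict_mono_fib_len: "strict_mono fib_len"
proof (rule strict_mono_Suc_iff[THEN iffD2], rule allI)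
  fix k show "fib_len k < fib_len (Suc k)"
    by (cases k) (use fib_len_gt[of "k - 1"] in auto)
qed

lemma fib_len_Suc_le: "fib_len (Suc k) \<le> 2 * fib_len k"
  by (cases k) (use strict_mono_less_eq[OF strict_mono_fib_len] in auto)

lemma ex_fib_len_bounds:
  assumes "1 \<le> m"
  obtains k where "fib_len k \<le> m" "m < fib_len (Suc k)"
proof -
  have "finite {k. fib_len k \<le> m}"
    by (rule finite_subset[of _ "{..m}"]) (use fib_len_gt in \<open>auto intro: order.trans less_imp_le\<close>)
  moreover have "0 \<in> {k. fib_len k \<le> m}" using assms by simp
  ultimately show ?thesis
    using that[of "Max {k. fib_len k \<le> m}"]
    by (metis (mono_tags, lifting) Max_ge Max_in empty_iff linorder_not_le mem_Collect_eq
        not_less_eq_eq order_refl)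
qed

section \<open>Letters of the Fibonacci word under shifts by Fibonacci numbers\<close>

lemma snth_fib_word: "i < fib_len k \<Longrightarrow> fib_word !! i = fib_iter k ! i"
  using fib_fixpoint_shift[OF fib_word_fixpoint, of k] by (metis fib_len_def shift_snth_less)

lemma snth_fib_word_add:
  assumes "i < fib_len k"
  shows "fib_word !! (i + fib_len (Suc k)) = fib_word !! i"
  using assms snth_fib_word[of "i + fib_len (Suc k)" "Suc (Suc k)"] snth_fib_word[of i k]
  by (simp add: fib_iter_rec nth_append fib_len_def[of "Suc k"])

text \<open>The words \<open>f\<^sub>k f\<^sub>k\<^sub>-\<^sub>1\<close> and \<open>f\<^sub>k\<^sub>-\<^sub>1 f\<^sub>k\<close> differ only in their last two letters.\<close>

lemma snth_fib_word_add_eq: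
  "i + 2 < fib_len (Suc k) \<Longrightarrow> fib_word !! (i + fib_len k) = fib_word !! i"
proof (induction k arbitrary: i)
  case (Suc k)
  show ?case
  proof (cases "i < fib_len k")
    case True
    then show ?thesis by (rule snth_fib_word_add)
  next
    case False
    define j where "j = i - fib_len k"
    have j: "i = j + fib_len k" using False by (simp add: j_def)
    have "fib_word !! (j + fib_len k) = fib_word !! j" using Suc j by simp
    moreover have "fib_word !! (j + fib_len (Suc (Suc k))) = fib_word !! j"
      using Suc.prems j by (intro snth_fib_word_add) simp
    ultimately show ?thesis by (simp add: j ac_simps)
  qed
qed simp

text \<open>\<open>fib_iter (k + 2)\<close> ends in \<open>fib_iter k\<close>, so from index 1 on
  the second to last letter depends only on the parity of the index. This makes the range in
  \<open>snth_fib_word_add_eq\<close> sharp.\<close>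

lemma snth_fib_word_neq:
  "fib_word !! (fib_len (Suc k) - 2) \<noteq> fib_word !! (fib_len (Suc (Suc k)) - 2)"
proof (induction k)
  case 0
  show ?case using snth_fib_word[of 0 2] snth_fib_word[of 1 2]
    by (simp add: numeral_2_eq_2 fib_iter_Suc fib_iter_0 fib_morph_def)
next
  case (Suc k)
  have "2 \<le> fib_len (Suc k)" using fib_len_gt[of "Suc k"] by simp
  moreover have "fib_len (Suc k) - 2 + fib_len (Suc (Suc k)) = fib_len (Suc (Suc (Suc k))) - 2"
    using calculation by simp
  ultimately have "fib_word !! (fib_len (Suc (Suc (Suc k))) - 2) = fib_word !! (fib_len (Suc k) - 2)"
    using snth_fib_word_add[of "fib_len (Suc k) - 2" "Suc k"] by simp
  then show ?case using Suc by simp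
qed

section \<open>Least periods of the prefixes\<close>

lemma is_period_fib_len:
  assumes "fib_len k \<le> n" "n + 2 \<le> fib_len (Suc (Suc k))"
  shows "is_period (stake n fib_word) (fib_len k)"
  using assms fib_len_gt[of k] snth_fib_word_add_eq[of _ k]
  unfolding is_period_stake by (auto simp: Suc_le_eq)

text \<open>
  Subtracting the smaller of two consecutive Fibonacci numbers from a period strictly between them
  would give a period of a shorter prefix that is too small.
\<close>

lemma fib_len_le_period:
  "is_period (stake (fib_len (Suc k) - 1) fib_word) p \<Longrightarrow> fib_len k \<le> p"
proof (induction k arbitrary: p rule: less_induct)
  case (less k)
  show ?case
  proof (rule ccontr)
    assume "\<not> fib_len k \<le> p"
    then have p: "p < fib_len k" by simp
    have "1 \<le> p" using less.prems by (simp add: is_period_stake)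
    with p obtain j where k: "k = Suc j" by (cases k) auto
    have mono: "a < b \<Longrightarrow> fib_len a < fib_len b" for a b
      using strict_mono_fib_len by (simp add: strict_mono_def)
    have "is_period (stake (fib_len (Suc j) - 1) fib_word) p"
      using p k by (intro is_period_stake_mono[OF less.prems]) auto
    then have "fib_len j \<le> p" using less.IH k by blast
    \<comment> \<open>The prefix is just long enough: its last index
      \<open>fib_len (j + 2) - 2\<close> is where the shift by \<open>fib_len j\<close> first
      fails.\<close>
    moreover have "p \<noteq> fib_len j"
    proof
      assume pj: "p = fib_len j"
      have "2 \<le> fib_len (Suc j)" using fib_len_gt[of "Suc j"] by simp
      then have "fib_word !! (fib_len (Suc j) - 2) = fib_word !! (fib_len (Suc j) - 2 + p)"
        using less.prems k pj by (simp add: is_period_stake)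
      moreover have "fib_len (Suc j) - 2 + p = fib_len (Suc (Suc j)) - 2"
        using pj \<open>2 \<le> fib_len (Suc j)\<close> by simp
      ultimately show False using snth_fib_word_neq[of j] by metis
    qed
    ultimately have pj: "fib_len j < p" by simp
    then have "fib_len (Suc j) > Suc (fib_len j)" using p k by simp
    then obtain i where j: "j = Suc i" by (cases j) auto
    define d where "d = p - fib_len j"
    have d: "p = fib_len j + d" "1 \<le> d" "d < fib_len i"
      using pj p k j by (auto simp: d_def)
    \<comment> \<open>A shift by \<open>p\<close> is a shift by \<open>d\<close> followed by one by
      \<open>fib_len j\<close>, and the latter preserves letters in this range.\<close>
    have "fib_word !! l = fib_word !! (l + d)" if "l + d < fib_len (Suc i) - 1" for l
    proof -
      have "fib_len (Suc i) \<le> fib_len (Suc j) - 1" using mono[of "Suc i" "Suc j"] j by simp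
      then have "l + d + 2 < fib_len (Suc j)" "l + p < fib_len (Suc k) - 1"
        using that d k j by auto
      then have "fib_word !! (l + d + fib_len j) = fib_word !! (l + d)"
        "fib_word !! l = fib_word !! (l + p)"
        using snth_fib_word_add_eq[of "l + d" j] less.prems by (auto simp: is_period_stake)
      then show ?thesis using d by (simp add: ac_simps)
    qed
    then have "is_period (stake (fib_len (Suc i) - 1) fib_word) d"
      using d mono[of i "Suc i"] by (auto simp: is_period_stake)
    then have "fib_len i \<le> d" using less.IH[of i d] k j by simp
    then show False using d by simp
  qed
qed

text \<open>A smaller period would survive truncation to length \<open>fib_len (k + 1) - 1\<close>,
  the shortest in the range, where \<open>fib_len_le_period\<close> excludes it.\<close>

lemma per_fib_word:
  assumes "fib_len (Suc k) \<le> n + 1" "n + 1 < fib_len (Suc (Suc k))"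
  shows "per (stake n fib_word) = fib_len k"
proof (rule per_eqI)
  have "fib_len k < fib_len (Suc k)"
    using strict_mono_fib_len by (simp add: strict_mono_def)
  then show "is_period (stake n fib_word) (fib_len k)"
    using assms by (intro is_period_fib_len) auto
  fix q assume q: "is_period (stake n fib_word) q"
  show "fib_len k \<le> q"
  proof (rule ccontr)
    assume "\<not> fib_len k \<le> q"
    then have "is_period (stake (fib_len (Suc k) - 1) fib_word) q"
      using assms \<open>fib_len k < fib_len (Suc k)\<close> by (intro is_period_stake_mono[OF q]) auto
    then show False using fib_len_le_period \<open>\<not> fib_len k \<le> q\<close> by blast
  qed
qed

section \<open>Number of periods of the prefixes\<close>

lemma nnp_fib_word_rec:
  assumes "fib_len (Suc k) \<le> n + 1" "n + 1 < fib_len (Suc (Suc k))" "fib_len k < n"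
  shows "nnp (stake n fib_word) = Suc (nnp (stake (n - fib_len k) fib_word))"
  using nnp_rec[of "stake n fib_word"] per_fib_word[OF assms(1,2)] assms(3)
  by (simp add: take_stake min_def)

lemma nnp_eq_0: "length w \<le> per w \<Longrightarrow> nnp w = 0"
  unfolding nnp_def using per_le[of w] by fastforce

lemma nnp_fib_word_bounds:
  assumes "fib_len k \<le> n + 1" "n + 1 < fib_len (Suc k)" "1 \<le> n"
  shows "nnp (stake n fib_word) \<le> k" "k \<le> 2 * nnp (stake n fib_word) + 2"
proof -
  have "nnp (stake n fib_word) \<le> k \<and> k \<le> 2 * nnp (stake n fib_word) + 2"
    using assms
  proof (induction n arbitrary: k rule: less_induct)
    case (less n)
    then obtain j where k: "k = Suc j" by (cases k) auto
    show ?case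
    proof (cases "fib_len j < n")
      case True
      define m where "m = n - fib_len j"
      have rec: "nnp (stake n fib_word) = Suc (nnp (stake m fib_word))"
        using nnp_fib_word_rec less.prems k True by (simp add: m_def)
      have m: "m < n" "1 \<le> m" "m + 1 < fib_len k"
        using True less.prems k fib_len_gt[of j] by (auto simp: m_def)
      from \<open>1 \<le> m\<close> \<open>m + 1 < fib_len k\<close> obtain i where j: "j = Suc i"
        using k by (cases j) auto
      have "fib_len i \<le> m + 1" using less.prems True k j by (simp add: m_def)
      show ?thesis
      \<comment> \<open>Since \<open>m + 1\<close> lies between \<open>fib_len i\<close> and
        \<open>fib_len k\<close>, the border has index \<open>j\<close> or \<open>i\<close>: a drop
        by one or by two.\<close>
      proof (cases "fib_len j \<le> m + 1")
        case True
        then show ?thesis using less.IH[of m j] m k rec by simp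
      next
        case False
        then show ?thesis
          using less.IH[of m i] m k rec j \<open>fib_len i \<le> m + 1\<close> by simp
      qed
    next
      \<comment> \<open>Only the prefixes of lengths one and two are unbordered. They have
        \<open>k \<le> 2\<close>, which accounts for the additive constant 2.\<close>
      case False
      then have "nnp (stake n fib_word) = 0"
        using per_fib_word[of j n] less.prems k by (intro nnp_eq_0) simp
      moreover have "j \<le> 1"
      proof (rule ccontr)
        assume "\<not> j \<le> 1"
        then obtain i where "j = Suc (Suc i)" by (metis One_nat_def le_0_eq le_SucI le_refl old.nat.exhaust)
        then have "fib_len (Suc j) \<ge> fib_len j + 2" using fib_len_gt[of "Suc i"] by simp
        then show False using False less.prems k by simp
      qed
      ultimately show ?thesis using k by simp
    qed
  qed
  then show "nnp (stake n fib_word) \<le> k" "k \<le> 2 * nnp (stake n fib_word) + 2" by auto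
qed

text \<open>Removing the least period \<open>fib_len (k + 1)\<close> from length
  \<open>fib_len (k + 3) - 2\<close> leaves \<open>fib_len (k + 2) - 2\<close>, a length of the same
  form. The descent ends at the prefix of length one.\<close>

lemma nnp_fib_word_max: "nnp (stake (fib_len (Suc (Suc k)) - 2) fib_word) = k"
proof (induction k)
  case 0
  show ?case by (simp add: nnp_def is_period_def)
next
  case (Suc k)
  have "k + 1 < fib_len (Suc k)" "fib_len (Suc k) < fib_len (Suc (Suc k))"
    using fib_len_gt[of "Suc k"] fib_len_gt[of k] by auto
  then show ?case
    using nnp_fib_word_rec[of "Suc k" "fib_len (Suc (Suc (Suc k))) - 2"] Suc fib_len_gt[of k]
    by (auto simp: algebra_simps)
qed

text \<open>For \<open>k > 2\<close> the least period is \<open>fib_len (k - 1)\<close>, so the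
  longest border has length \<open>fib_len (k - 2) - 1\<close>: the same form, two indices
  lower.\<close>

lemma nnp_fib_word_min: "2 * nnp (stake (fib_len k - 1) fib_word) \<le> k"
proof (induction k rule: less_induct)
  case (less k)
  show ?case
  \<comment> \<open>The recursion needs \<open>fib_len (k - 1) < fib_len k - 1\<close>, which fails
    up to index 2.\<close>
  proof (cases "k \<le> 2")
    case True
    then consider "k = 0" | "k = 1" | "k = Suc (Suc 0)" by linarith
    then show ?thesis
    proof cases
      case 3
      have "per (stake 2 fib_word) = 2" using per_fib_word[of 1 2] by simp
      then show ?thesis using 3 nnp_eq_0[of "stake 2 fib_word"]
        by (simp add: numeral_2_eq_2)
    qed (simp_all add: nnp_eq_0 per_fib_word[of 0 1, simplified])
  next
    case False
    then obtain i where k: "k = Suc (Suc (Suc i))"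
      by (metis not_less_eq_eq numeral_2_eq_2 old.nat.exhaust zero_le)
    have "nnp (stake (fib_len k - 1) fib_word) = Suc (nnp (stake (fib_len (Suc i) - 1) fib_word))"
      using nnp_fib_word_rec[of "Suc (Suc i)" "fib_len k - 1"] k fib_len_gt[of i] fib_len_gt[of "Suc i"]
      by (auto simp: algebra_simps)
    then show ?thesis using less.IH[of "Suc i"] k by simp
  qed
qed

section \<open>Numerical bounds for \<open>tau\<close> and \<open>ln tau\<close>\<close>

lemma tau_sq: "tau\<^sup>2 = tau + 1"
  by (simp add: tau_def power2_eq_square field_simps)

lemma tau_bounds: "161803398874 / 10 ^ 11 \<le> tau" "tau \<le> 161803398875 / 10 ^ 11"
proof -
  have "223606797748 / 10 ^ 11 \<le> sqrt 5" by (rule real_le_rsqrt) (simp add: power2_eq_square)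
  then show "161803398874 / 10 ^ 11 \<le> tau" by (simp add: tau_def)
  have "sqrt 5 \<le> 223606797750 / 10 ^ 11" by (rule real_le_lsqrt) (simp_all add: power2_eq_square)
  then show "tau \<le> 161803398875 / 10 ^ 11" by (simp add: tau_def)
qed

text \<open>Seven terms of the series \<open>2 * (y + y ^ 3 / 3 + y ^ 5 / 5 + ...)\<close> for
  \<open>ln tau\<close>, where \<open>y = (tau - 1) / (tau + 1)\<close>, leave a remainder of at
  most \<open>8 / 10 ^ 11\<close>.\<close>

lemma ln_tau_bounds: "48121182500 / 10 ^ 11 \<le> ln tau" "ln tau \<le> 48121182510 / 10 ^ 11"
proof -
  \<comment> \<open>Exact powers of \<open>(tau - 1) / (tau + 1) = sqrt 5 - 2\<close> keep the numerals in the series small.\<close>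
  define s where "s = sqrt 5"
  define y where "y = s - 2"
  have s: "s * s = 5" by (simp add: s_def)
  \<comment> \<open>The closed forms of the powers of \<open>y\<close> subtract nearly equal
    numbers, some above \<open>10 ^ 9\<close>, so \<open>sqrt 5\<close> is needed to many more
    digits than the result.\<close>
  have s_ge: "223606797749978969640 / 10 ^ 20 \<le> s"
    unfolding s_def by (rule real_le_rsqrt) (simp add: power2_eq_square)
  have s_le: "s \<le> 223606797749978969641 / 10 ^ 20"
    unfolding s_def by (rule real_le_lsqrt) (simp_all add: power2_eq_square)
  have y: "(tau - 1) / (tau + 1) = y"
    using s tau_bounds by (simp add: tau_def y_def field_simps flip: s_def)
  have y2: "y\<^sup>2 = 9 - 4 * s" by (simp add: y_def power2_eq_square algebra_simps s)
  have step: "y ^ (n + 2) = (9 * a + 4 * b) * s - (20 * a + 9 * b)" if "y ^ n = a * s - b" for n a b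
  proof -
    have "y ^ (n + 2) = (a * s - b) * (9 - 4 * s)" by (simp only: power_add y2 that)
    also have "\<dots> = (9 * a + 4 * b) * s - 4 * a * (s * s) - 9 * b" by (simp only: algebra_simps)
    finally show ?thesis by (simp add: s)
  qed
  have y3: "y ^ 3 = 17 * s - 38" by (simp add: y_def power3_eq_cube algebra_simps s)
  have y5: "y ^ 5 = 305 * s - 682" using step[OF y3] by simp
  have y7: "y ^ 7 = 5473 * s - 12238" using step[OF y5] by simp
  have y9: "y ^ 9 = 98209 * s - 219602" using step[OF y7] by simp
  have y11: "y ^ 11 = 1762289 * s - 3940598" using step[OF y9] by simp
  have y13: "y ^ 13 = 31622993 * s - 70711162" using step[OF y11] by simp
  have y15: "y ^ 15 = 567451585 * s - 1268860318" using step[OF y13] by simp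
  define A where "A = (\<Sum>k<7. 2 * y ^ (2 * k + 1) / real (2 * k + 1))"
  define d where "d = y ^ 15 / (1 - y\<^sup>2) / 15"
  have A: "A =
      46928018818 / 9009 * s - 524671178956 / 45045"
    unfolding A_def
    by (simp add: lessThan_nat_numeral y3 y5 y7 y9 y11 y13 del: power_Suc) (simp add: y_def field_simps)
  have A_bounds: "48121182500 / 10 ^ 11 \<le> A" "A \<le> 481211825012 / 10 ^ 12"
    using s_ge s_le unfolding A by simp_all
  have "d \<le> 5 / 10 ^ 10 / (9 / 10) / 15"
    unfolding d_def using s_ge s_le by (intro frac_le divide_right_mono) (simp_all add: y15 y2)
  also have "\<dots> \<le> 4 / 10 ^ 11" by simp
  finally have d: "d \<le> 4 / 10 ^ 11" .
  have "1 < tau" using tau_bounds by simp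
  from ln_approx_bounds[OF this, of 7, unfolded y, folded A_def]
  have ln: "A \<le> ln tau" "ln tau \<le> A + 2 * d"
    by (simp_all add: d_def)
  from A_bounds(1) ln(1) show "48121182500 / 10 ^ 11 \<le> ln tau" by linarith
  from A_bounds(2) ln(2) d show "ln tau \<le> 48121182510 / 10 ^ 11" by simp
qed

lemma tau_sq_ln_tau_bounds:
  "12598289130 / 10 ^ 10 \<le> tau\<^sup>2 * ln tau" "tau\<^sup>2 * ln tau \<le> 12598289150 / 10 ^ 10"
proof -
  have "12598289130 / 10 ^ 10 \<le> (161803398874 / 10 ^ 11 + 1) * (48121182500 / 10 ^ 11 :: real)"
    by simp
  also have "\<dots> \<le> tau\<^sup>2 * ln tau"
    unfolding tau_sq using tau_bounds(1) ln_tau_bounds(1) by (intro mult_mono) auto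
  finally show "12598289130 / 10 ^ 10 \<le> tau\<^sup>2 * ln tau" .
  have "tau\<^sup>2 * ln tau \<le> (161803398875 / 10 ^ 11 + 1) * (48121182510 / 10 ^ 11)"
    unfolding tau_sq using tau_bounds ln_tau_bounds by (intro mult_mono) auto
  also have "\<dots> \<le> 12598289150 / 10 ^ 10" by simp
  finally show "tau\<^sup>2 * ln tau \<le> 12598289150 / 10 ^ 10" .
qed

section \<open>Growth of Fibonacci numbers and the initial critical exponent\<close>

lemma fib_len_tau_bounds: "tau ^ k \<le> real (fib_len k)" "real (fib_len k) \<le> tau ^ Suc k"
proof -
  have pow: "tau ^ Suc (Suc j) = tau ^ Suc j + tau ^ j" for j
    using arg_cong[OF tau_sq, of "\<lambda>x. x * tau ^ j"] by (simp add: power2_eq_square algebra_simps)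
  have "tau ^ k \<le> real (fib_len k) \<and> real (fib_len k) \<le> tau ^ Suc k"
  proof (induction k rule: induct_nat_012)
    case (ge2 k)
    then show ?case using pow[of k] pow[of "Suc k"] by (simp del: power_Suc)
  qed (use tau_bounds tau_sq in \<open>auto simp: power2_eq_square\<close>)
  then show "tau ^ k \<le> real (fib_len k)" "real (fib_len k) \<le> tau ^ Suc k" by auto
qed

text \<open>The difference equals \<open>fib_len (k + 1) - tau * fib_len k\<close>, a geometric
  sequence whose ratio is the conjugate root \<open>1 - tau\<close>, of modulus below one.\<close>

lemma fib_len_tau_sq: "\<bar>real (fib_len (Suc (Suc k))) - tau\<^sup>2 * real (fib_len k)\<bar> \<le> 1"
proof -
  define e where "e j = real (fib_len (Suc j)) - tau * real (fib_len j)" for j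
  have e_Suc: "e (Suc j) = (1 - tau) * e j" for j
    using arg_cong[OF tau_sq, of "\<lambda>x. x * real (fib_len j)"]
    by (simp add: e_def power2_eq_square algebra_simps)
  have "\<bar>e j\<bar> \<le> 1" for j
  proof (induction j)
    case (Suc j)
    have "\<bar>1 - tau\<bar> \<le> 1" using tau_bounds by auto
    then have "\<bar>1 - tau\<bar> * \<bar>e j\<bar> \<le> 1" using Suc by (intro mult_le_one) auto
    then show ?case by (simp add: e_Suc abs_mult)
  qed (use tau_bounds in \<open>simp add: e_def\<close>)
  moreover have "real (fib_len (Suc (Suc k))) - tau\<^sup>2 * real (fib_len k) = e k"
    unfolding tau_sq by (simp add: e_def algebra_simps)
  ultimately show ?thesis by metis
qed

text \<open>The longest prefix with least period \<open>fib_len k\<close> has length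
  \<open>fib_len (k + 2) - 2\<close>. The subtracted 2 outweighs the error 1 in
  \<open>fib_len_tau_sq\<close>, so the bound holds exactly and not only in the limit.\<close>

lemma word_exp_fib_word_le:
  assumes "1 \<le> n"
  shows "word_exp (stake n fib_word) \<le> tau\<^sup>2"
proof -
  obtain k' where k': "fib_len k' \<le> n + 1" "n + 1 < fib_len (Suc k')"
    using ex_fib_len_bounds[of "n + 1"] by auto
  then obtain k where k: "k' = Suc k" using assms by (cases k') auto
  have "real n + 2 \<le> real (fib_len (Suc (Suc k)))" using k' k by simp
  also have "\<dots> \<le> tau\<^sup>2 * real (fib_len k) + 1" using fib_len_tau_sq[of k] by linarith
  finally have "real n \<le> tau\<^sup>2 * real (fib_len k)" by simp
  moreover have "per (stake n fib_word) = fib_len k" using k' k per_fib_word by blast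
  moreover have "0 < fib_len k" using fib_len_gt[of k] by simp
  ultimately show ?thesis by (simp add: word_exp_def divide_le_eq)
qed

lemma ice_stake: "ice (stake n s) = Sup ((\<lambda>m. word_exp (stake m s)) ` {1..n})"
proof -
  have "{word_exp u |u. u \<noteq> [] \<and> prefix u (stake n s)} = (\<lambda>m. word_exp (stake m s)) ` {1..n}"
    unfolding prefix_stake_iff
    by (auto simp: Suc_le_eq simp flip: length_greater_0_conv) (metis length_stake)
  then show ?thesis by (simp add: ice_def)
qed

lemma ice_fib_word_le: "1 \<le> n \<Longrightarrow> ice (stake n fib_word) \<le> tau\<^sup>2"
  unfolding ice_stake by (rule cSup_least) (auto intro: word_exp_fib_word_le)

lemma ice_fib_word_ge:
  assumes "2 \<le> n"
  shows "tau\<^sup>2 - 24 / real n \<le> ice (stake n fib_word)"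
proof -
  obtain k' where k': "fib_len k' \<le> n + 1" "n + 1 < fib_len (Suc k')"
    using ex_fib_len_bounds[of "n + 1"] by auto
  have "1 < k'"
  proof (rule ccontr)
    assume "\<not> 1 < k'"
    then have "k' = 0 \<or> k' = 1" by auto
    then show False using k' assms by auto
  qed
  then obtain k where k: "k' = Suc (Suc k)" by (metis One_nat_def less_imp_Suc_add add_Suc)
  have pos: "0 < fib_len k" using fib_len_gt[of k] by simp
  \<comment> \<open>The longest prefix with least period \<open>fib_len k\<close>. Its exponent
    misses \<open>tau\<^sup>2\<close> by at most \<open>3 / fib_len k\<close>: 2 from the length and
    1 from \<open>fib_len_tau_sq\<close>.\<close>
  define m where "m = fib_len (Suc (Suc k)) - 2"
  have less: "fib_len k < fib_len (Suc k)"
    using strict_mono_fib_len by (simp add: strict_mono_def)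
  have m: "1 \<le> m" "m \<le> n" "m + 2 = fib_len (Suc (Suc k))"
    using less pos k' k by (auto simp: m_def)
  have per: "per (stake m fib_word) = fib_len k"
    using m less pos by (intro per_fib_word) auto
  \<comment> \<open>Three doublings lead from index \<open>k\<close> to \<open>k + 3\<close>;
    together with the error 3 they give the constant 24.\<close>
  have "n \<le> 8 * fib_len k"
    using k' k fib_len_Suc_le[of k] fib_len_Suc_le[of "Suc k"] fib_len_Suc_le[of "Suc (Suc k)"]
    by simp
  then have n: "real n \<le> 8 * real (fib_len k)" by linarith
  have "3 / real (fib_len k) \<le> 24 / real n"
    using n pos assms by (simp add: field_simps)
  then have "tau\<^sup>2 - 24 / real n \<le> tau\<^sup>2 - 3 / real (fib_len k)" by simp
  also have "\<dots> = (tau\<^sup>2 * real (fib_len k) - 1 - 2) / real (fib_len k)"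
    using pos by (simp add: field_simps)
  also have "\<dots> \<le> real m / real (fib_len k)"
  proof (rule divide_right_mono)
    have "real m + 2 = real (fib_len (Suc (Suc k)))" using m(3) by linarith
    then show "tau\<^sup>2 * real (fib_len k) - 1 - 2 \<le> real m"
      using fib_len_tau_sq[of k] by linarith
  qed simp
  also have "\<dots> = word_exp (stake m fib_word)" by (simp add: word_exp_def per)
  also have "\<dots> \<le> ice (stake n fib_word)"
    unfolding ice_stake using m word_exp_fib_word_le
    by (intro cSup_upper) (auto intro!: bdd_aboveI2)
  finally show ?thesis .
qed

lemma ice_fib_word_tendsto: "(\<lambda>n. ice (stake n fib_word)) \<longlonglongrightarrow> tau\<^sup>2"
proof (rule tendsto_sandwich)
  show "\<forall>\<^sub>F n in sequentially. tau\<^sup>2 - 24 / real n \<le> ice (stake n fib_word)"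
    using eventually_ge_at_top[of 2] by eventually_elim (rule ice_fib_word_ge)
  show "\<forall>\<^sub>F n in sequentially. ice (stake n fib_word) \<le> tau\<^sup>2"
    using eventually_ge_at_top[of 1] by eventually_elim (rule ice_fib_word_le)
  have "(\<lambda>n. tau\<^sup>2 - 24 / real n) \<longlonglongrightarrow> tau\<^sup>2 - 0"
    by (intro tendsto_diff tendsto_const lim_const_over_n)
  then show "(\<lambda>n. tau\<^sup>2 - 24 / real n) \<longlonglongrightarrow> tau\<^sup>2" by simp
qed simp

section \<open>Comparison of \<open>period_ratio\<close> with convergent sequences\<close>

definition fib_ratio_bound :: "real \<Rightarrow> nat \<Rightarrow> real" where
  "fib_ratio_bound a n = (ln (real n) + a) / ln tau / (ice (stake n fib_word) * ln (real n))"

text \<open>The shift \<open>a\<close> absorbs the bounded errors in the estimates of the number of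
  periods; it vanishes after division by \<open>ln n\<close>.\<close>

lemma fib_ratio_bound_tendsto: "fib_ratio_bound a \<longlonglongrightarrow> 1 / (tau\<^sup>2 * ln tau)"
proof -
  have tau: "tau \<noteq> 0" "ln tau \<noteq> 0" using tau_bounds ln_tau_bounds by auto
  have ln: "filterlim (\<lambda>n. ln (real n)) at_top sequentially"
    by (rule filterlim_compose[OF ln_at_top filterlim_real_sequentially])
  have "(\<lambda>n. (1 + a / ln (real n)) / (ln tau * ice (stake n fib_word)))
      \<longlonglongrightarrow> (1 + 0) / (ln tau * tau\<^sup>2)"
    by (intro tendsto_intros ice_fib_word_tendsto tendsto_divide_0[OF tendsto_const]
        filterlim_at_top_imp_at_infinity[OF ln]) (use tau in auto)
  moreover have "\<forall>\<^sub>F n in sequentially. fib_ratio_bound a n =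
      (1 + a / ln (real n)) / (ln tau * ice (stake n fib_word))"
    using eventually_ge_at_top[of 2]
  proof eventually_elim
    case (elim n)
    then have "ln (real n) \<noteq> 0" by auto
    then have "(1 + a / ln (real n)) = (ln (real n) + a) / ln (real n)"
      by (simp add: field_simps)
    then show ?case by (simp add: fib_ratio_bound_def ac_simps)
  qed
  ultimately show ?thesis by (simp add: filterlim_cong ac_simps)
qed

lemma ice_times_ln_pos:
  assumes "2 \<le> n"
  shows "0 < ice (stake n fib_word) * ln (real n)"
proof -
  have "per (stake 1 fib_word) = 1" using per_fib_word[of 0 1] by simp
  then have "1 = word_exp (stake 1 fib_word)" by (simp add: word_exp_def)
  also have "\<dots> \<le> ice (stake n fib_word)"
    unfolding ice_stake using assms word_exp_fib_word_le
    by (intro cSup_upper imageI) (auto intro!: bdd_aboveI2)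
  finally show ?thesis using assms by simp
qed

text \<open>The factor \<open>c\<close> will be 1 for the limit superior and 2 for the limit
  inferior.\<close>

lemma period_ratio_le_fib_ratio_bound:
  assumes "2 \<le> n" "c * real (nnp (stake n fib_word)) * ln tau \<le> ln (real n) + a"
  shows "c * period_ratio (stake n fib_word) \<le> fib_ratio_bound a n"
proof -
  have "0 < ln tau" using ln_tau_bounds by auto
  then have "c * real (nnp (stake n fib_word)) \<le> (ln (real n) + a) / ln tau"
    using assms by (simp add: pos_le_divide_eq)
  then show ?thesis
    using ice_times_ln_pos[OF assms(1)] divide_right_mono
    by (fastforce simp: period_ratio_def fib_ratio_bound_def)
qed

lemma fib_ratio_bound_le_period_ratio:
  assumes "2 \<le> n" "ln (real n) + a \<le> c * real (nnp (stake n fib_word)) * ln tau"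
  shows "fib_ratio_bound a n \<le> c * period_ratio (stake n fib_word)"
proof -
  have "0 < ln tau" using ln_tau_bounds by auto
  then have "(ln (real n) + a) / ln tau \<le> c * real (nnp (stake n fib_word))"
    using assms by (simp add: pos_divide_le_eq)
  then show ?thesis
    using ice_times_ln_pos[OF assms(1)] divide_right_mono
    by (fastforce simp: period_ratio_def fib_ratio_bound_def)
qed

lemma ln_fib_len_bounds:
  "real k * ln tau \<le> ln (real (fib_len k))" "ln (real (fib_len k)) \<le> (real k + 1) * ln tau"
proof -
  have "0 < tau" "0 < fib_len k" using tau_bounds fib_len_gt[of k] by auto
  then have "ln (tau ^ k) \<le> ln (real (fib_len k))" "ln (real (fib_len k)) \<le> ln (tau ^ Suc k)"
    using fib_len_tau_bounds by (subst ln_le_cancel_iff; simp)+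
  then show "real k * ln tau \<le> ln (real (fib_len k))"
    "ln (real (fib_len k)) \<le> (real k + 1) * ln tau"
    using \<open>0 < tau\<close> by (simp_all add: ln_realpow ac_simps del: power_Suc)
qed

lemma ln_add_one_le:
  assumes "1 \<le> n"
  shows "ln (real (n + 1)) \<le> ln (real n) + 1"
proof -
  have "ln (real (n + 1)) \<le> ln (2 * real n)" using assms by (subst ln_le_cancel_iff) auto
  also have "\<dots> = ln 2 + ln (real n)" using assms by (simp add: ln_mult)
  also have "ln 2 \<le> (1 :: real)" using ln_le_minus_one[of "2 :: real"] by simp
  finally show ?thesis by simp
qed

lemma nnp_fib_word_ln_bounds:
  assumes "1 \<le> n"
  shows "real (nnp (stake n fib_word)) * ln tau \<le> ln (real n) + 1"
    and "ln (real n) - 4 \<le> 2 * real (nnp (stake n fib_word)) * ln tau"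
proof -
  obtain k where k: "fib_len k \<le> n + 1" "n + 1 < fib_len (Suc k)"
    using ex_fib_len_bounds[of "n + 1"] by auto
  note nnp = nnp_fib_word_bounds[OF k assms]
  have tau: "0 < ln tau" "ln tau \<le> 1" using ln_tau_bounds by auto
  have "real (nnp (stake n fib_word)) * ln tau \<le> real k * ln tau"
    using nnp(1) tau by (intro mult_right_mono) auto
  also have "\<dots> \<le> ln (real (fib_len k))" by (rule ln_fib_len_bounds)
  also have "\<dots> \<le> ln (real (n + 1))"
    using k(1) fib_len_gt[of k] by (subst ln_le_cancel_iff) auto
  also have "\<dots> \<le> ln (real n) + 1" by (rule ln_add_one_le[OF assms])
  finally show "real (nnp (stake n fib_word)) * ln tau \<le> ln (real n) + 1" .
  have "ln (real n) \<le> ln (real (fib_len (Suc k)))"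
    using k(2) assms by (subst ln_le_cancel_iff) auto
  also have "\<dots> \<le> (real (Suc k) + 1) * ln tau" by (rule ln_fib_len_bounds)
  \<comment> \<open>Here \<open>k + 2 \<le> 2 * nnp + 4\<close>; as \<open>ln tau \<le> 1\<close>,
    the surplus becomes the additive constant 4.\<close>
  also have "\<dots> \<le> (2 * real (nnp (stake n fib_word)) + 4) * ln tau"
    using nnp(2) tau by (intro mult_right_mono) auto
  also have "\<dots> \<le> 2 * real (nnp (stake n fib_word)) * ln tau + 4"
    using tau by (simp add: algebra_simps)
  finally show "ln (real n) - 4 \<le> 2 * real (nnp (stake n fib_word)) * ln tau" by simp
qed

text \<open>The hypothesis keeps the truncated subtraction exact, so that no two values collapse to
  0.\<close>

lemma strict_mono_fib_len_diff:
  assumes "\<And>k. d \<le> fib_len (k + i)"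
  shows "strict_mono (\<lambda>k. fib_len (k + i) - d)"
proof (rule strict_monoI)
  fix x y :: nat assume "x < y"
  then have "fib_len (x + i) < fib_len (y + i)"
    using strict_mono_fib_len by (simp add: strict_mono_def)
  then show "fib_len (x + i) - d < fib_len (y + i) - d"
    using assms[of x] by simp
qed

section \<open>Limit superior and limit inferior\<close>

lemma limsup_eqI_subseq:
  fixes u b c :: "nat \<Rightarrow> real"
  assumes "\<forall>\<^sub>F n in sequentially. u n \<le> b n" "b \<longlonglongrightarrow> l"
    and "strict_mono r" "\<forall>\<^sub>F k in sequentially. c (r k) \<le> u (r k)" "c \<longlonglongrightarrow> l"
  shows "limsup (\<lambda>n. ereal (u n)) = ereal l"
proof (rule antisym)
  have "limsup (\<lambda>n. ereal (u n)) \<le> limsup (\<lambda>n. ereal (b n))"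
    using assms(1) by (intro Limsup_mono) simp
  also have "\<dots> = ereal l" using assms(2) by (intro lim_imp_Limsup) auto
  finally show "limsup (\<lambda>n. ereal (u n)) \<le> ereal l" .
  have "ereal l = limsup (\<lambda>k. ereal (c (r k)))"
    using LIMSEQ_subseq_LIMSEQ[OF assms(5,3)]
    by (intro lim_imp_Limsup[symmetric]) (auto simp: o_def)
  also have "\<dots> \<le> limsup (\<lambda>k. ereal (u (r k)))"
    using assms(4) by (intro Limsup_mono) simp
  also have "\<dots> \<le> limsup (\<lambda>n. ereal (u n))"
    using limsup_subseq_mono[OF assms(3), of "\<lambda>n. ereal (u n)"] by (simp add: o_def)
  finally show "ereal l \<le> limsup (\<lambda>n. ereal (u n))" .
qed

lemma liminf_eqI_subseq:
  fixes u b c :: "nat \<Rightarrow> real"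
  assumes "\<forall>\<^sub>F n in sequentially. b n \<le> u n" "b \<longlonglongrightarrow> l"
    and "strict_mono r" "\<forall>\<^sub>F k in sequentially. u (r k) \<le> c (r k)" "c \<longlonglongrightarrow> l"
  shows "liminf (\<lambda>n. ereal (u n)) = ereal l"
proof (rule antisym)
  have "ereal l = liminf (\<lambda>n. ereal (b n))"
    using assms(2) by (intro lim_imp_Liminf[symmetric]) auto
  also have "\<dots> \<le> liminf (\<lambda>n. ereal (u n))"
    using assms(1) by (intro Liminf_mono) simp
  finally show "ereal l \<le> liminf (\<lambda>n. ereal (u n))" .
  have "liminf (\<lambda>n. ereal (u n)) \<le> liminf (\<lambda>k. ereal (u (r k)))"
    using liminf_subseq_mono[OF assms(3), of "\<lambda>n. ereal (u n)"] by (simp add: o_def)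
  also have "\<dots> \<le> liminf (\<lambda>k. ereal (c (r k)))"
    using assms(4) by (intro Liminf_mono) simp
  also have "\<dots> = ereal l"
    using LIMSEQ_subseq_LIMSEQ[OF assms(5,3)]
    by (intro lim_imp_Liminf) (auto simp: o_def)
  finally show "liminf (\<lambda>n. ereal (u n)) \<le> ereal l" .
qed

lemma limsup_ratio_fib_word: "limsup_ratio fib_word = ereal (1 / (tau\<^sup>2 * ln tau))"
  unfolding limsup_ratio_def
proof (rule limsup_eqI_subseq[OF _ fib_ratio_bound_tendsto _ _ fib_ratio_bound_tendsto])
  show "\<forall>\<^sub>F n in sequentially. period_ratio (stake n fib_word) \<le> fib_ratio_bound 1 n"
    using eventually_ge_at_top[of 2]
  proof eventually_elim
    case (elim n)
    then show ?case
      using period_ratio_le_fib_ratio_bound[of n 1 1] nnp_fib_word_ln_bounds(1)[of n] by simp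
  qed
  let ?r = "\<lambda>k. fib_len (k + 2) - 2"
  show "strict_mono ?r"
    by (rule strict_mono_fib_len_diff) (metis add_leD2 fib_len_gt less_imp_le order.trans)
  \<comment> \<open>There are exactly \<open>k\<close> periods, while
    \<open>ln (fib_len (k + 2)) \<le> (k + 3) * ln tau\<close>; with \<open>ln tau \<le> 1\<close>
    this gives the shift \<open>- 3\<close>.\<close>
  show "\<forall>\<^sub>F k in sequentially. fib_ratio_bound (- 3) (?r k) \<le> period_ratio (stake (?r k) fib_word)"
    using eventually_ge_at_top[of 2]
  proof eventually_elim
    case (elim k)
    have n: "2 \<le> ?r k" using fib_len_gt[of "k + 2"] elim by simp
    have "ln (real (?r k)) \<le> ln (real (fib_len (k + 2)))"
      using n by (subst ln_le_cancel_iff) auto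
    also have "\<dots> \<le> (real (k + 2) + 1) * ln tau" by (rule ln_fib_len_bounds)
    also have "\<dots> \<le> real k * ln tau + 3" using ln_tau_bounds by (simp add: algebra_simps)
    finally have "ln (real (?r k)) + - 3 \<le> 1 * real (nnp (stake (?r k) fib_word)) * ln tau"
      using nnp_fib_word_max[of k] by (simp add: numeral_2_eq_2)
    from fib_ratio_bound_le_period_ratio[OF n this] show ?case by simp
  qed
qed

lemma liminf_ratio_fib_word: "liminf_ratio fib_word = ereal (1 / (2 * tau\<^sup>2 * ln tau))"
  unfolding liminf_ratio_def
proof (rule liminf_eqI_subseq)
  have lim: "(\<lambda>n. fib_ratio_bound a n / 2) \<longlonglongrightarrow> 1 / (2 * tau\<^sup>2 * ln tau)" for a
    using tendsto_divide[OF fib_ratio_bound_tendsto[of a] tendsto_const[of 2]] by (simp add: ac_simps)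
  show "(\<lambda>n. fib_ratio_bound (- 4) n / 2) \<longlonglongrightarrow> 1 / (2 * tau\<^sup>2 * ln tau)"
    "(\<lambda>n. fib_ratio_bound 1 n / 2) \<longlonglongrightarrow> 1 / (2 * tau\<^sup>2 * ln tau)"
    by (rule lim)+
  show "\<forall>\<^sub>F n in sequentially. fib_ratio_bound (- 4) n / 2 \<le> period_ratio (stake n fib_word)"
    using eventually_ge_at_top[of 2]
  proof eventually_elim
    case (elim n)
    then show ?case
      using fib_ratio_bound_le_period_ratio[of n "- 4" 2] nnp_fib_word_ln_bounds(2)[of n] by simp
  qed
  \<comment> \<open>The lengths of \<open>nnp_fib_word_min\<close>; the \<open>+ 0\<close> fits the
    form of \<open>strict_mono_fib_len_diff\<close>.\<close>
  let ?r = "\<lambda>k. fib_len (k + 0) - 1"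
  show "strict_mono ?r"
    by (rule strict_mono_fib_len_diff) (metis One_nat_def Suc_leI fib_len_gt gr_zeroI not_less_zero)
  show "\<forall>\<^sub>F k in sequentially. period_ratio (stake (?r k) fib_word) \<le> fib_ratio_bound 1 (?r k) / 2"
    using eventually_ge_at_top[of 2]
  proof eventually_elim
    case (elim k)
    have n: "2 \<le> ?r k" using fib_len_gt[of k] elim by simp
    have "2 * real (nnp (stake (?r k) fib_word)) \<le> real k"
      using nnp_fib_word_min[of k] by simp
    then have "2 * real (nnp (stake (?r k) fib_word)) * ln tau \<le> real k * ln tau"
      using ln_tau_bounds by (intro mult_right_mono) auto
    also have "\<dots> \<le> ln (real (?r k + 1))" using ln_fib_len_bounds(1)[of k] n by simp
    also have "\<dots> \<le> ln (real (?r k)) + 1" using n by (intro ln_add_one_le) simp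
    finally show ?case using period_ratio_le_fib_ratio_bound[OF n, of 2 1] by simp
  qed
qed

theorem theorem13:
  shows "limsup_ratio fib_word = ereal (1 / (tau\<^sup>2 * ln tau))
       \<and> \<bar>1 / (tau\<^sup>2 * ln tau) - 0.79375857\<bar> \<le> 5 / 10 ^ 9
       \<and> liminf_ratio fib_word = ereal (1 / (2 * tau\<^sup>2 * ln tau))
       \<and> \<bar>1 / (2 * tau\<^sup>2 * ln tau) - 0.396879286\<bar> \<le> 5 / 10 ^ 10"
proof -
  define x where "x = 1 / (tau\<^sup>2 * ln tau)"
  have pos: "0 < tau\<^sup>2 * ln tau" using tau_sq_ln_tau_bounds(1) by simp
  have "x \<le> 1 / (12598289130 / 10 ^ 10)"
    unfolding x_def by (rule divide_left_mono[OF tau_sq_ln_tau_bounds(1)]) (use pos in auto)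
  \<comment> \<open>This rounding is just sharp enough: half of it exceeds
    \<open>0.396879286\<close> by exactly \<open>5 / 10 ^ 10\<close>.\<close>
  then have x_le: "x \<le> 793758573 / 10 ^ 9" by simp
  have "1 / (12598289150 / 10 ^ 10) \<le> x"
    unfolding x_def by (rule divide_left_mono[OF tau_sq_ln_tau_bounds(2)]) (use pos in auto)
  then have x_ge: "7937585715 / 10 ^ 10 \<le> x" by simp
  have "1 / (2 * tau\<^sup>2 * ln tau) = x / 2" by (simp add: x_def)
  moreover have "\<bar>x - 0.79375857\<bar> \<le> 5 / 10 ^ 9" "\<bar>x / 2 - 0.396879286\<bar> \<le> 5 / 10 ^ 10"
    using x_le x_ge by (intro abs_leI; simp)+
  ultimately show ?thesis
    using limsup_ratio_fib_word liminf_ratio_fib_word unfolding x_def by metis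
qed

end
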